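(* Let $1<p,q<\infty$ with $\frac1p+\frac1q=1$. Let $(\mathcal{M},0)$ be a pointed metric space with metric $d(\cdot,\cdot)$ and let $\mathcal{X}$ be a Banach space over $\mathbb{K}$. Let $f=\{f_n\}_{n=1}^\infty$ in $\operatorname{Lip}_0(\mathcal{M},\mathbb{K})$ be a pointed Lipschitz $p$-Bessel sequence for $(\mathcal{M},0)$ with bound $b>0$, let $\tau=\{\tau_n\}_{n=1}^\infty$ in $\mathcal{X}$ be a pointed Lipschitz $q$-Bessel sequence for $\operatorname{Lip}_0(\mathcal{X},\mathbb{K})$ with bound $D>0$, and let $\lambda=\{\lambda_n\}_n\in\ell^\infty(\mathbb{N})$. For each $k\in\mathbb{N}$ let $\lambda^{(k)}=\{\lambda_n^{(k)}\}_n\in\ell^\infty(\mathbb{N})$ and let $\tau^{(k)}=\{\tau_n^{(k)}\}_n$ be a sequence in $\mathcal{X}$ that is a pointed Lipschitz $q$-Bessel sequence for $\operatorname{Lip}_0(\mathcal{X},\mathbb{K})$ (with some bound). Then: (i) If $\lambda^{(k)}\to\lambda$ in $p$-norm as $k\to\infty$, i.e. $\big(\sum_{n=1}^\infty|\lambda_n^{(k)}-\lambda_n|^p\big)^{1/p}\to0$ as $k\to\infty$, then $$\|M_{\lambda^{(k)},f,\tau}-M_{\lambda,f,\tau}\|_{\operatorname{Lip}_0}\to0\quad\text{as }k\to\infty.$$ (ii) If $\{\lambda_n\}_n\in\ell^p(\mathbb{N})$ and $\sum_{n=1}^\infty\|\tau_n^{(k)}-\tau_n\|^q\to0$ as $k\to\infty$,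 then $$\|M_{\lambda,f,\tau^{(k)}}-M_{\lambda,f,\tau}\|_{\operatorname{Lip}_0}\to0\quad\text{as }k\to\infty.$$
   Context: $\mathbb{K}$ denotes $\mathbb{R}$ or $\mathbb{C}$. A pointed metric space $(\mathcal{M},0)$ is a metric space with a distinguished point denoted $0$; a Banach space $\mathcal{X}$ is regarded as a pointed metric space with its zero vector as distinguished point. For a pointed metric space $(\mathcal{M},0)$ and a Banach space $\mathcal{X}$, $\operatorname{Lip}_0(\mathcal{M},\mathcal{X})$ is the Banach space of Lipschitz maps $f:\mathcal{M}\to\mathcal{X}$ with $f(0)=0$, with norm $$\|f\|_{\operatorname{Lip}_0}=\sup_{x,y\in\mathcal{M},\,x\ne y}\frac{\|f(x)-f(y)\|}{d(x,y)}.$$ A sequence $\{f_n\}_n$ in $\operatorname{Lip}_0(\mathcal{M},\mathbb{K})$ is a pointed Lipschitz $p$-Bessel sequence for $(\mathcal{M},0)$ with bound $b>0$ if $$\Big(\sum_{n=1}^\infty|f_n(x)-f_n(y)|^p\Big)^{1/p}\le b\,d(x,y)\quad\text{for all }x,y\in\mathcal{M}.$$ A sequence $\{\tau_n\}_n$ in $\mathcal{X}$ is a pointed Lipschitz $q$-Bessel sequence for $\operatorname{Lip}_0(\mathcal{X},\mathbb{K})$ with bound $D>0$ if $$\Big(\sum_{n=1}^\infty|f(\tau_n)-g(\tau_n)|^q\Big)^{1/q}\le D\,\|f-g\|_{\operatorname{Lip}_0}\quad\text{for all }f,g\in\operatorname{Lip}_0(\mathcal{X},\mathbb{K}).$$ For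 such $f=\{f_n\}_n$ and $\tau=\{\tau_n\}_n$ and for $\lambda=\{\lambda_n\}_n\in\ell^\infty(\mathbb{N})$, the Lipschitz $(p,q)$-Bessel multiplier $M_{\lambda,f,\tau}:\mathcal{M}\to\mathcal{X}$ is defined by $$M_{\lambda,f,\tau}(x)=\sum_{n=1}^\infty\lambda_n f_n(x)\tau_n,\quad x\in\mathcal{M};$$ the series converges in norm for every $x\in\mathcal{M}$ and $M_{\lambda,f,\tau}\in\operatorname{Lip}_0(\mathcal{M},\mathcal{X})$. *)

theory Defs
  imports "HOL-Analysis.Analysis"
begin

(* The scalar field K is a type of class real_normed_field. By Gelfand-Mazur such a field is,
   isometrically, the reals or the complex numbers, so the class is exactly "K = R or C".
   The library has no class of Banach spaces over a variable scalar field: a Banach space over K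
   is a type of class banach together with a K-scalar multiplication that is compatible
   with the norm and extends the real one. *)
locale banach_space_over = vector_space smul
  for smul :: "'k::real_normed_field \<Rightarrow> 'x::banach \<Rightarrow> 'x" +
  assumes norm_scale: "norm (smul c x) = norm c * norm x"
    and scale_of_real: "smul (of_real r) x = r *\<^sub>R x"

(* The distinguished point of the domain is an explicit argument. *)
definition Lip0 :: "'m::metric_space \<Rightarrow> ('m \<Rightarrow> 'x::real_normed_vector) set" where
  "Lip0 z = {f. (\<exists>L. L-lipschitz_on UNIV f) \<and> f z = 0}"

(* Extended-valued, so that the supremum over the empty set (one-point domain) is 0
   and non-Lipschitz maps get the value \<infinity>. *)
definition lip_norm :: "('m::metric_space \<Rightarrow> 'x::real_normed_vector) \<Rightarrow> ennreal" where
  "lip_norm f = (SUP (x, y) \<in> {(x, y). x \<noteq> y}. ennreal (norm (f x - f y) / dist x y))"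

definition power_sum :: "real \<Rightarrow> (nat \<Rightarrow> 'x::real_normed_vector) \<Rightarrow> ennreal" where
  "power_sum p a = (\<Sum>n. ennreal (norm (a n) powr p))"

definition lp_norm :: "real \<Rightarrow> (nat \<Rightarrow> 'x::real_normed_vector) \<Rightarrow> ennreal" where
  "lp_norm p a =
     (if power_sum p a = \<infinity> then \<infinity> else ennreal (enn2real (power_sum p a) powr (1 / p)))"

definition lipschitz_bessel ::
  "real \<Rightarrow> 'm::metric_space \<Rightarrow> real \<Rightarrow> (nat \<Rightarrow> 'm \<Rightarrow> 'k::real_normed_field) \<Rightarrow> bool" where
  "lipschitz_bessel p z b f \<longleftrightarrow>
     b > 0 \<and> (\<forall>n. f n \<in> Lip0 z) \<and>
     (\<forall>x y. lp_norm p (\<lambda>n. f n x - f n y) \<le> ennreal (b * dist x y))"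

(* The first argument only serves to fix the scalar field 'k in which the test functions
   take their values. *)
definition lipschitz_bessel_dual ::
  "'k::real_normed_field itself \<Rightarrow> real \<Rightarrow> real \<Rightarrow> (nat \<Rightarrow> 'x::real_normed_vector) \<Rightarrow> bool" where
  "lipschitz_bessel_dual K q D t \<longleftrightarrow>
     D > 0 \<and>
     (\<forall>g \<in> Lip0 0. \<forall>h \<in> Lip0 0.
        lp_norm q (\<lambda>n. g (t n) - h (t n) :: 'k) \<le> ennreal D * lip_norm (\<lambda>x. g x - h x))"

definition multiplier ::
  "('k::real_normed_field \<Rightarrow> 'x::real_normed_vector \<Rightarrow> 'x) \<Rightarrow>
   (nat \<Rightarrow> 'k) \<Rightarrow> (nat \<Rightarrow> 'm \<Rightarrow> 'k) \<Rightarrow> (nat \<Rightarrow> 'x) \<Rightarrow> 'm \<Rightarrow> 'x" where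
  "multiplier smul l f t x = (\<Sum>n. smul (l n * f n x) (t n))"

end

theory Submission
  imports Defs
begin

text \<open>The \<open>\<ell>\<^sup>q\<close>-norm of a dual \<open>q\<close>-Bessel sequence \<open>\<tau>\<close> is itself at most \<open>D\<close>: test the Bessel
  inequality on the 1-Lipschitz function \<open>x \<mapsto> \<parallel>x\<parallel>\<close>.  Hence, by Hoelder's inequality, the Lipschitz
  norm of \<open>M\<^bsub>c,f,t\<^esub>\<close> is at most \<open>\<parallel>c\<parallel>\<^sub>\<infinity> \<sqdot> b \<sqdot> \<parallel>t\<parallel>\<^sub>q\<close>.  The two differences in the theorem are again
  multipliers, with symbol \<open>\<lambda>\<^sup>k - \<lambda>\<close> (whose supremum norm is at most its \<open>p\<close>-norm) and with
  sequence \<open>\<tau>\<^sup>k - \<tau>\<close>, respectively.\<close>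

text \<open>Dividing by \<open>A\<close> and \<open>B\<close> reduces the claim to Young's
  inequality in each term. Any upper bounds \<open>A\<close>, \<open>B\<close> may be used in place
  of the norms themselves, so a bound for a whole series also serves its partial sums.\<close>

lemma sum_mult_le_Holder:
  fixes a b :: "'i \<Rightarrow> real"
  assumes pq: "1 < p" "1 < q" "1 / p + 1 / q = 1"
    and a: "\<And>i. i \<in> I \<Longrightarrow> 0 \<le> a i" and b: "\<And>i. i \<in> I \<Longrightarrow> 0 \<le> b i"
    and A: "0 \<le> A" "(\<Sum>i\<in>I. a i powr p) \<le> A powr p"
    and B: "0 \<le> B" "(\<Sum>i\<in>I. b i powr q) \<le> B powr q"
  shows "(\<Sum>i\<in>I. a i * b i) \<le> A * B"
proof (cases "finite I \<and> A > 0 \<and> B > 0")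
  case True
  then have fin: "finite I" and pos: "A > 0" "B > 0" by auto
  have "(\<Sum>i\<in>I. (a i / A) * (b i / B)) \<le> (\<Sum>i\<in>I. (a i / A) powr p / p + (b i / B) powr q / q)"
    using a b pos pq by (intro sum_mono Youngs_inequality) auto
  also have "\<dots> = (\<Sum>i\<in>I. a i powr p) / A powr p / p + (\<Sum>i\<in>I. b i powr q) / B powr q / q"
    using a b pos by (simp add: powr_divide sum.distrib sum_divide_distrib)
  also have "\<dots> \<le> 1 / p + 1 / q"
    using A B pos pq by (intro add_mono divide_right_mono) auto
  finally have "(\<Sum>i\<in>I. a i * b i) / (A * B) \<le> 1"
    using pq by (simp add: sum_divide_distrib)
  then show ?thesis using pos by (simp add: divide_le_eq)
next
  case False
  \<comment> \<open>Here \<open>0 powr r\<close> is 0 for every \<open>r\<close>, so a vanishing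
    bound forces every term to vanish.\<close>
  have zero: "\<forall>i\<in>I. u i = 0" if "finite I" "(\<Sum>i\<in>I. u i powr r) \<le> 0 powr r" for u :: "'i \<Rightarrow> real" and r
  proof -
    have "(\<Sum>i\<in>I. u i powr r) = 0" using that by (intro antisym sum_nonneg) auto
    then show ?thesis using that(1) by (simp add: sum_nonneg_eq_0_iff)
  qed
  \<comment> \<open>Over an infinite index set the sum is 0 by convention.\<close>
  consider "infinite I" | "finite I" "A = 0" | "finite I" "B = 0" using False A B by linarith
  then show ?thesis
  proof cases
    case 1 then show ?thesis using A B by simp
  next
    case 2 then show ?thesis using zero[of a p] A by simp
  next
    case 3 then show ?thesis using zero[of b q] B by simp
  qed
qed

text \<open>Undoes the root: a finite bound excludes the infinite branch of \<open>lp_norm\<close>,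
  and raising to the power \<open>p\<close> is monotone.\<close>

lemma power_sum_le_of_lp_norm_le:
  assumes "0 < p" "0 \<le> C" "lp_norm p a \<le> ennreal C"
  shows "power_sum p a \<le> ennreal (C powr p)"
proof -
  have fin: "power_sum p a \<noteq> \<infinity>"
    using assms(3) by (auto simp: lp_norm_def top_unique split: if_splits)
  then have "enn2real (power_sum p a) powr (1 / p) \<le> C"
    using assms by (simp add: lp_norm_def ennreal_le_iff)
  then have "(enn2real (power_sum p a) powr (1 / p)) powr p \<le> C powr p"
    using assms(1) by (intro powr_mono2) auto
  then have "enn2real (power_sum p a) \<le> C powr p"
    using assms(1) by (simp add: powr_powr)
  then show ?thesis
    using fin by (metis ennreal_enn2real ennreal_leI infinity_ennreal_def less_top)
qed

lemma sum_powr_le_of_lp_norm_le: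
  assumes "0 < p" "0 \<le> C" "lp_norm p a \<le> ennreal C" "finite N"
  shows "(\<Sum>n\<in>N. norm (a n) powr p) \<le> C powr p"
proof -
  have "ennreal (\<Sum>n\<in>N. norm (a n) powr p) = (\<Sum>n\<in>N. ennreal (norm (a n) powr p))"
    by simp
  also have "\<dots> \<le> power_sum p a"
    unfolding power_sum_def using assms(4) by (intro sum_le_suminf) auto
  also have "\<dots> \<le> ennreal (C powr p)"
    using assms by (intro power_sum_le_of_lp_norm_le)
  finally show ?thesis by (subst (asm) ennreal_le_iff) auto
qed

text \<open>A single term is already a partial sum, so the supremum norm is dominated by the
  \<open>p\<close>-norm. This turns \<open>p\<close>-norm convergence of the symbols into uniform
  convergence.\<close>

lemma norm_le_of_lp_norm_le:
  assumes "0 < p" "0 \<le> C" "lp_norm p a \<le> ennreal C"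
  shows "norm (a n) \<le> C"
proof -
  have "norm (a n) powr p \<le> C powr p"
    using sum_powr_le_of_lp_norm_le[OF assms, of "{n}"] by simp
  then show ?thesis
    using assms by (meson norm_ge_zero not_le powr_less_mono2)
qed

text \<open>Bridges the hypothesis of (ii), stated for sums of powers, to the norm in which the
  estimates are linear.\<close>

lemma tendsto_lp_norm_zero:
  assumes "0 < p" "(\<lambda>k. power_sum p (a k)) \<longlonglongrightarrow> 0"
  shows "(\<lambda>k. lp_norm p (a k)) \<longlonglongrightarrow> 0"
proof -
  have "(\<lambda>k. enn2real (power_sum p (a k))) \<longlonglongrightarrow> 0"
    using assms(2) tendsto_enn2real[of _ 0] by simp
  then have "(\<lambda>k. enn2real (power_sum p (a k)) powr (1 / p)) \<longlonglongrightarrow> 0"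
    using assms(1) by (intro tendsto_zero_powrI[OF _ tendsto_const]) auto
  then have "(\<lambda>k. ennreal (enn2real (power_sum p (a k)) powr (1 / p))) \<longlonglongrightarrow> 0"
    using tendsto_ennrealI by fastforce
  \<comment> \<open>\<open>enn2real\<close> sends infinity to 0, so the two expressions agree only
    where the power sum is finite, which holds eventually.\<close>
  moreover have "\<forall>\<^sub>F k in sequentially. power_sum p (a k) < \<infinity>"
    using assms(2) by (rule order_tendstoD) simp
  then have "\<forall>\<^sub>F k in sequentially.
      ennreal (enn2real (power_sum p (a k)) powr (1 / p)) = lp_norm p (a k)"
    by eventually_elim (simp add: lp_norm_def)
  ultimately show ?thesis by (rule Lim_transform_eventually)
qed

lemma lip_norm_le:
  assumes "\<And>x y. norm (f x - f y) \<le> C * dist x y"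
  shows "lip_norm f \<le> ennreal C"
  unfolding lip_norm_def
proof (intro SUP_least, clarify)
  fix x y :: 'a assume "x \<noteq> y"
  then show "ennreal (norm (f x - f y) / dist x y) \<le> ennreal C"
    using assms[of x y] by (intro ennreal_leI) (simp add: divide_le_eq)
qed

lemma lipschitz_bessel_dual_lp_norm_le:
  assumes "lipschitz_bessel_dual TYPE('k::real_normed_field) q D t"
  shows "lp_norm q t \<le> ennreal D"
proof -
  \<comment> \<open>\<open>of_real\<close> moves the norm into the scalar field without changing its
    size, so \<open>g (t n)\<close> and \<open>t n\<close> have equal norms. The second test
    function will be zero.\<close>
  define g where "g x = (of_real (norm x) :: 'k)" for x :: 'a
  have g: "norm (g x - g y) \<le> 1 * dist x y" for x y
    unfolding g_def by (simp flip: of_real_diff add: dist_norm norm_triangle_ineq3)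
  then have "1-lipschitz_on UNIV g"
    by (intro lipschitz_onI) (auto simp: dist_norm)
  then have "g \<in> Lip0 0" by (auto simp: Lip0_def g_def)
  moreover have "(\<lambda>_. 0 :: 'k) \<in> Lip0 (0 :: 'a)"
    by (auto simp: Lip0_def intro!: exI[of _ 0] lipschitz_onI)
  ultimately have "lp_norm q (\<lambda>n. g (t n) - (\<lambda>_. 0) (t n))
      \<le> ennreal D * lip_norm (\<lambda>x. g x - (\<lambda>_. 0) x)"
    using assms unfolding lipschitz_bessel_dual_def by (elim conjE) (drule (1) bspec)+
  also have "\<dots> \<le> ennreal D * ennreal 1"
    using lip_norm_le[of g 1] g by (intro mult_left_mono) auto
  finally have "lp_norm q (\<lambda>n. g (t n)) \<le> ennreal D" by simp
  moreover have "power_sum q (\<lambda>n. g (t n)) = power_sum q t"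
    by (simp add: power_sum_def g_def)
  ultimately show ?thesis by (simp only: lp_norm_def)
qed

context banach_space_over
begin

text \<open>Pulling out \<open>C\<close> and applying Hoelder to partial sums bounds the sums of
  norms uniformly; absolute convergence and completeness give both claims.\<close>

lemma
  assumes pq: "1 < p" "1 < q" "1 / p + 1 / q = 1"
    and c: "\<And>n. norm (c n) \<le> C"
    and u: "0 \<le> A" "lp_norm p u \<le> ennreal A"
    and t: "0 \<le> B" "lp_norm q t \<le> ennreal B"
  shows summable_smul: "summable (\<lambda>n. smul (c n * u n) (t n))"
    and norm_suminf_smul_le: "norm (\<Sum>n. smul (c n * u n) (t n)) \<le> C * A * B"
proof -
  have C: "0 \<le> C" using c norm_ge_zero order_trans by blast
  have "(\<Sum>n<N. norm (smul (c n * u n) (t n))) \<le> C * A * B" for N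
  proof -
    have "(\<Sum>n<N. norm (u n) * norm (t n)) \<le> A * B"
      using pq u t by (intro sum_mult_le_Holder[OF pq] sum_powr_le_of_lp_norm_le) auto
    then have "C * (\<Sum>n<N. norm (u n) * norm (t n)) \<le> C * (A * B)"
      using C by (rule mult_left_mono)
    moreover have "(\<Sum>n<N. norm (smul (c n * u n) (t n))) \<le> (\<Sum>n<N. C * (norm (u n) * norm (t n)))"
      using c by (intro sum_mono) (simp add: norm_scale norm_mult mult.assoc mult_right_mono)
    ultimately show ?thesis by (simp add: sum_distrib_left mult.assoc)
  qed
  moreover from this have sum: "summable (\<lambda>n. norm (smul (c n * u n) (t n)))"
    by (intro summableI_nonneg_bounded) auto
  ultimately have "(\<Sum>n. norm (smul (c n * u n) (t n))) \<le> C * A * B"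
    by (intro suminf_le_const)
  then show "norm (\<Sum>n. smul (c n * u n) (t n)) \<le> C * A * B"
    using summable_norm[OF sum] by linarith
  show "summable (\<lambda>n. smul (c n * u n) (t n))"
    using sum by (rule summable_norm_cancel)
qed

lemma summable_multiplier:
  assumes pq: "1 < p" "1 < q" "1 / p + 1 / q = 1"
    and c: "bounded (range c)"
    and f: "lipschitz_bessel p z b f"
    and t: "lp_norm q t < \<infinity>"
  shows "summable (\<lambda>n. smul (c n * f n x) (t n))"
proof -
  obtain C where C: "\<And>n. norm (c n) \<le> C" using c by (auto simp: bounded_iff)
  obtain B where B: "0 \<le> B" "lp_norm q t \<le> ennreal B"
    using t by (cases "lp_norm q t") auto
  \<comment> \<open>Comparing \<open>x\<close> with the base point \<open>z\<close>, where all
    \<open>f n\<close> vanish, turns the Bessel inequality for differences into a bound on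
    \<open>f n x\<close> itself.\<close>
  have fx: "lp_norm p (\<lambda>n. f n x - f n z) \<le> ennreal (b * dist x z)" and b: "0 < b"
    using f unfolding lipschitz_bessel_def by blast+
  have fz: "f n z = 0" for n
    using f by (auto simp: lipschitz_bessel_def Lip0_def)
  show ?thesis
    using summable_smul[OF pq C _ fx B] b fz by simp
qed

lemma lip_norm_multiplier_le:
  assumes pq: "1 < p" "1 < q" "1 / p + 1 / q = 1"
    and c: "\<And>n. norm (c n) \<le> C"
    and f: "lipschitz_bessel p z b f"
    and t: "0 \<le> B" "lp_norm q t \<le> ennreal B"
  shows "lip_norm (multiplier smul c f t) \<le> ennreal (C * b * B)"
proof (rule lip_norm_le)
  fix x y
  have b: "0 < b" "lp_norm p (\<lambda>n. f n x - f n y) \<le> ennreal (b * dist x y)"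
    using f by (auto simp: lipschitz_bessel_def)
  have bdd: "bounded (range c)" using c by (auto simp: bounded_iff)
  have fin: "lp_norm q t < \<infinity>" using t(2) ennreal_less_top infinity_ennreal_def le_less_trans by metis
  note s = summable_multiplier[OF pq bdd f fin]
  \<comment> \<open>Convergence of both series allows termwise subtraction; the Bessel inequality
    then supplies \<open>A = b * dist x y\<close>.\<close>
  have "multiplier smul c f t x - multiplier smul c f t y
      = (\<Sum>n. smul (c n * (f n x - f n y)) (t n))"
    unfolding multiplier_def suminf_diff[OF s s]
    by (simp add: right_diff_distrib scale_left_diff_distrib)
  also have "norm \<dots> \<le> C * (b * dist x y) * B"
    using b by (intro norm_suminf_smul_le[OF pq c _ _ t]) auto
  finally show "norm (multiplier smul c f t x - multiplier smul c f t y) \<le> C * b * B * dist x y"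
    by (simp add: mult_ac)
qed

end

theorem theorem3p12:
  fixes p q b D :: real
    and z :: "'m::metric_space"
    and smul :: "'k::real_normed_field \<Rightarrow> 'x::banach \<Rightarrow> 'x"
    and f :: "nat \<Rightarrow> 'm \<Rightarrow> 'k"
    and \<tau> :: "nat \<Rightarrow> 'x"
    and l :: "nat \<Rightarrow> 'k"
    and lk :: "nat \<Rightarrow> nat \<Rightarrow> 'k"
    and \<tau>k :: "nat \<Rightarrow> nat \<Rightarrow> 'x"
  assumes "1 < p" and "1 < q" and "1 / p + 1 / q = 1"
    and "banach_space_over smul"
    and "lipschitz_bessel p z b f"
    and "lipschitz_bessel_dual TYPE('k) q D \<tau>"
    and "bounded (range l)"
    and "\<And>k. bounded (range (lk k))"
    and "\<And>k. \<exists>D'. lipschitz_bessel_dual TYPE('k) q D' (\<tau>k k)"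
  shows "((\<lambda>k. lp_norm p (\<lambda>n. lk k n - l n)) \<longlonglongrightarrow> 0 \<longrightarrow>
          (\<lambda>k. lip_norm (\<lambda>x. multiplier smul (lk k) f \<tau> x - multiplier smul l f \<tau> x)) \<longlonglongrightarrow> 0)
       \<and> (lp_norm p l < \<infinity> \<and> (\<lambda>k. power_sum q (\<lambda>n. \<tau>k k n - \<tau> n)) \<longlonglongrightarrow> 0 \<longrightarrow>
          (\<lambda>k. lip_norm (\<lambda>x. multiplier smul l f (\<tau>k k) x - multiplier smul l f \<tau> x)) \<longlonglongrightarrow> 0)"
proof -
  interpret banach_space_over smul by fact
  note pq = assms(1-3) and f = assms(5)
  have b: "0 < b" using f by (simp add: lipschitz_bessel_def)
  have dual: "lp_norm q \<tau> \<le> ennreal D" "0 < D"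
    using assms(6) lipschitz_bessel_dual_lp_norm_le by (auto simp: lipschitz_bessel_dual_def)
  then have fin: "lp_norm q \<tau> < \<infinity>"
    using ennreal_less_top infinity_ennreal_def le_less_trans by metis
  have fink: "lp_norm q (\<tau>k k) < \<infinity>" for k
    using assms(9)[of k] lipschitz_bessel_dual_lp_norm_le
    by (metis ennreal_less_top infinity_ennreal_def le_less_trans)
  note s = summable_multiplier[OF pq assms(7) f fin]
    and sk = summable_multiplier[OF pq assms(8) f fin]
    and s\<tau>k = summable_multiplier[OF pq assms(7) f fink]
  \<comment> \<open>Strict positivity of \<open>L\<close> matters: in \<open>ennreal\<close>, zero
    times infinity is 0, which would spoil the bound below when the \<open>q\<close>-norm is
    infinite.\<close>
  obtain L where L: "0 < L" "\<And>n. norm (l n) \<le> L"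
    using assms(7) by (auto simp: bounded_pos)

  have squeeze: "u \<longlonglongrightarrow> 0" if "v \<longlonglongrightarrow> 0" "\<And>k. u k \<le> ennreal c * v k"
    for u v :: "nat \<Rightarrow> ennreal" and c
    using that ennreal_tendsto_cmult[of "ennreal c" v 0]
    by (intro tendsto_sandwich[of "\<lambda>_. 0" u _ "\<lambda>k. ennreal c * v k"]) auto

  \<comment> \<open>The sequence is fixed with norm at most \<open>D\<close> and the symbol varies.
    If the \<open>p\<close>-norm is infinite, so is the right-hand side, because
    \<open>b * D\<close> is positive.\<close>
  have i: "lip_norm (\<lambda>x. multiplier smul (lk k) f \<tau> x - multiplier smul l f \<tau> x)
      \<le> ennreal (b * D) * lp_norm p (\<lambda>n. lk k n - l n)" for k
  proof (cases "lp_norm p (\<lambda>n. lk k n - l n)")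
    case (real C)
    have "(\<lambda>x. multiplier smul (lk k) f \<tau> x - multiplier smul l f \<tau> x)
        = multiplier smul (\<lambda>n. lk k n - l n) f \<tau>"
      unfolding multiplier_def suminf_diff[OF sk s]
      by (simp add: left_diff_distrib scale_left_diff_distrib)
    moreover have "norm (lk k n - l n) \<le> C" for n
      using real pq by (intro norm_le_of_lp_norm_le[of p C "\<lambda>n. lk k n - l n"]) auto
    ultimately have "lip_norm (\<lambda>x. multiplier smul (lk k) f \<tau> x - multiplier smul l f \<tau> x)
        \<le> ennreal (C * b * D)"
      using lip_norm_multiplier_le[OF pq _ f] dual by simp
    then show ?thesis
      using real b dual by (simp add: mult_ac flip: ennreal_mult)
  qed (use b dual in \<open>simp add: ennreal_mult_top\<close>)
  \<comment> \<open>The roles are exchanged: the symbol is fixed with bound \<open>L\<close>, and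
    the difference of sequences carries the \<open>q\<close>-norm.\<close>
  have ii: "lip_norm (\<lambda>x. multiplier smul l f (\<tau>k k) x - multiplier smul l f \<tau> x)
      \<le> ennreal (L * b) * lp_norm q (\<lambda>n. \<tau>k k n - \<tau> n)" for k
  proof (cases "lp_norm q (\<lambda>n. \<tau>k k n - \<tau> n)")
    case (real B)
    have "(\<lambda>x. multiplier smul l f (\<tau>k k) x - multiplier smul l f \<tau> x)
        = multiplier smul l f (\<lambda>n. \<tau>k k n - \<tau> n)"
      unfolding multiplier_def suminf_diff[OF s\<tau>k s]
      by (simp add: scale_right_diff_distrib)
    then have "lip_norm (\<lambda>x. multiplier smul l f (\<tau>k k) x - multiplier smul l f \<tau> x)
        \<le> ennreal (L * b * B)"
      using lip_norm_multiplier_le[OF pq L(2) f] real by simp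
    then show ?thesis
      using real b L by (simp flip: ennreal_mult)
  qed (use b L in \<open>simp add: ennreal_mult_top\<close>)
  have "0 < q" using pq by simp
  show ?thesis
    by (intro conjI impI squeeze[OF _ i] squeeze[OF tendsto_lp_norm_zero[OF \<open>0 < q\<close>] ii]) simp_all
qed

end
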